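(* Let $B_1$ and $B_2$ be Boolean algebras and let $h\colon B_1\to B_2$ be a Boolean homomorphism. Then $h^\sigma=(h_*^\beta)^*$ as maps $\mathcal{P}(\mathsf{Uf}(B_1))\to\mathcal{P}(\mathsf{Uf}(B_2))$, where $h^\sigma$ is the canonical extension of $h$ and $(h_*^\beta)^*$ is the Boolean dual of the Stone-Čech extension $h_*^\beta\colon\beta(\mathsf{Uf}(B_2))\to\beta(\mathsf{Uf}(B_1))$ of the Stone dual $h_*$ of $h$ (with $\mathsf{Uf}(B_1)$ and $\mathsf{Uf}(B_2)$ regarded as discrete spaces).
   Context: For a Boolean algebra $B$, $\mathsf{Fi}(B)$ is the set of all (not necessarily proper) filters of $B$, $\mathsf{Uf}(B)$ is the set of all ultrafilters of $B$, and $\mathcal{P}(X)$ denotes the power set of $X$. Canonical extension. The map $\varphi\colon B\to\mathcal{P}(\mathsf{Uf}(B))$ is $\varphi(a)=\{u\in\mathsf{Uf}(B): a\in u\}$. The canonical extension $B^\sigma$ of $B$ is identified with the pair $\langle\mathcal{P}(\mathsf{Uf}(B)),\varphi\rangle$. Write $\varphi_i$ for the map $\varphi$ associated with $B_i$, $i=1,2$. The canonical extension of an order-preserving map $h\colon B_1\to B_2$ is the map $h^\sigma\colon\mathcal{P}(\mathsf{Uf}(B_1))\to\mathcal{P}(\mathsf{Uf}(B_2))$ given by $$h^\sigma(A)=\bigcup\left\{\bigcap\{\varphi_2(h(a)): a\in F\}: F\in\mathsf{Fi}(B_1),\ \bigcap\varphi_1[F]\subseteq A\right\},$$ where $\varphi_1[F]=\{\varphi_1(a):a\in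 F\}$. Stone duality. The dual Stone space $B_*$ of a Boolean algebra $B$ is $\mathsf{Uf}(B)$ with the topology generated by the base $\{\varphi(a):a\in B\}$. The dual of a Boolean homomorphism $h\colon B_1\to B_2$ is $h_*\colon\mathsf{Uf}(B_2)\to\mathsf{Uf}(B_1)$, $h_*(v)=h^{-1}[v]$. Stone-Čech compactification. For a discrete space $X$, the Stone-Čech compactification is identified with $\beta X=\mathcal{P}(X)_*$, the Stone space of the Boolean algebra $\mathcal{P}(X)$, with embedding $x\mapsto\{A\subseteq X: x\in A\}$. For $i=1,2$ regard $\mathsf{Uf}(B_i)$ as a discrete space and let $\beta_i\colon\mathsf{Uf}(B_i)\to\beta(\mathsf{Uf}(B_i))$ be this embedding. For a Boolean homomorphism $h\colon B_1\to B_2$, $h_*^\beta\colon\beta(\mathsf{Uf}(B_2))\to\beta(\mathsf{Uf}(B_1))$ denotes the unique continuous map with $h_*^\beta\circ\beta_2=\beta_1\circ h_*$ (it exists by the universal property of the Stone-Čech compactification). The dual $(h_*^\beta)^*$. For $i=1,2$ let $\widehat{\varphi_i}\colon\mathcal{P}(\mathsf{Uf}(B_i))\to\mathcal{P}(\beta(\mathsf{Uf}(B_i)))$ be $\widehat{\varphi_i}(A)=\{\nabla\in\beta(\mathsf{Uf}(B_i)): A\in\nabla\}$; this is an isomorphism of $\mathcal{P}(\mathsf{Uf}(B_i))$ onto the Boolean algebra of clopen subsets of $\beta(\mathsf{Uf}(B_i))$. The Boolean dual $(h_*^\beta)^*\colon\mathcal{P}(\mathsf{Uf}(B_1))\to\mathcal{P}(\mathsf{Uf}(B_2))$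 is defined by: $(h_*^\beta)^*(A)=B$ if and only if $\widehat{\varphi_2}(B)=(h_*^\beta)^{-1}\left(\widehat{\varphi_1}(A)\right)$. *)

theory Defs
  imports "HOL-Analysis.Analysis"
begin

text \<open>
  Filters and ultrafilters are taken relative to a carrier \<open>S\<close> inside a lattice type, with the
  inherited order and meet.  Two carriers occur: \<open>S = UNIV\<close> for a Boolean algebra given as a type of
  class \<^class>\<open>boolean_algebra\<close>, and \<open>S = Pow X\<close> for the powerset algebra of a set \<open>X\<close>, where order
  and meet are inclusion and intersection.  The carrier is needed because the set of ultrafilters
  of a Boolean algebra is not a type (it is empty for the one-element algebra).
\<close>

definition Fi :: "'a::lattice set \<Rightarrow> 'a set set" where
  "Fi S = {F. F \<subseteq> S \<and> F \<noteq> {} \<and>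
              (\<forall>a\<in>F. \<forall>b\<in>F. inf a b \<in> F) \<and>
              (\<forall>a\<in>F. \<forall>b\<in>S. a \<le> b \<longrightarrow> b \<in> F)}"

definition Uf :: "'a::lattice set \<Rightarrow> 'a set set" where
  "Uf S = {u \<in> Fi S. u \<noteq> S \<and> (\<forall>F\<in>Fi S. u \<subseteq> F \<longrightarrow> F = u \<or> F = S)}"

definition phi :: "'a::lattice set \<Rightarrow> 'a \<Rightarrow> 'a set set" where
  "phi S a = {u \<in> Uf S. a \<in> u}"

definition boolean_hom :: "('a::boolean_algebra \<Rightarrow> 'b::boolean_algebra) \<Rightarrow> bool" where
  "boolean_hom h \<longleftrightarrow>
     (\<forall>a b. h (inf a b) = inf (h a) (h b)) \<and>
     (\<forall>a b. h (sup a b) = sup (h a) (h b)) \<and>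
     (\<forall>a. h (- a) = - h a) \<and>
     h bot = bot \<and> h top = top"

definition canonical_extension ::
  "('a::boolean_algebra \<Rightarrow> 'b::boolean_algebra) \<Rightarrow> 'a set set \<Rightarrow> 'b set set" where
  "canonical_extension h A =
     \<Union> {\<Inter> {phi UNIV (h a) | a. a \<in> F} | F. F \<in> Fi UNIV \<and> \<Inter> (phi UNIV ` F) \<subseteq> A}"

definition stone_space :: "'a::lattice set \<Rightarrow> 'a set topology" where
  "stone_space S = topology_generated_by (phi S ` S)"

definition stone_dual ::
  "('a::boolean_algebra \<Rightarrow> 'b::boolean_algebra) \<Rightarrow> 'b set \<Rightarrow> 'a set" where
  "stone_dual h v = h -` v"

text \<open>
  The Stone-Cech compactification of a discrete space \<open>X\<close> is the Stone space of its powerset algebra.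
\<close>

definition stone_cech :: "'x set \<Rightarrow> 'x set set topology" where
  "stone_cech X = stone_space (Pow X)"

definition stone_cech_embed :: "'x set \<Rightarrow> 'x \<Rightarrow> 'x set set" where
  "stone_cech_embed X x = {A. A \<subseteq> X \<and> x \<in> A}"

text \<open>
  Functions in HOL are total, so uniqueness of the continuous extension only holds once its values
  outside the space are fixed; this is the purpose of \<^const>\<open>extensional\<close>.
\<close>

definition stone_cech_dual ::
  "('a::boolean_algebra \<Rightarrow> 'b::boolean_algebra) \<Rightarrow> 'b set set set \<Rightarrow> 'a set set set" where
  "stone_cech_dual h =
     (THE g. g \<in> extensional (topspace (stone_cech (Uf (UNIV :: 'b set)))) \<and>
             continuous_map (stone_cech (Uf (UNIV :: 'b set))) (stone_cech (Uf (UNIV :: 'a set))) g \<and>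
             (\<forall>v \<in> Uf (UNIV :: 'b set).
                g (stone_cech_embed (Uf UNIV) v) = stone_cech_embed (Uf UNIV) (stone_dual h v)))"

text \<open>
  The Boolean dual of a map \<open>g\<close> from the compactification of \<open>Y\<close> to that of \<open>X\<close>.  The
  isomorphism of \<open>Pow X\<close> onto the clopen subsets of the compactification of \<open>X\<close> (often written as
  phi with a hat) is \<^const>\<open>phi\<close> taken for the powerset algebra.
\<close>

definition boolean_dual ::
  "'x set \<Rightarrow> 'y set \<Rightarrow> ('y set set \<Rightarrow> 'x set set) \<Rightarrow> 'x set \<Rightarrow> 'y set" where
  "boolean_dual X Y g A =
     (THE B. B \<subseteq> Y \<and>
             phi (Pow Y) B = {n \<in> topspace (stone_cech Y). g n \<in> phi (Pow X) A})"

end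

theory Submission
  imports Defs
begin

text \<open>
  Both maps send \<open>A\<close> to its preimage \<open>{v \<in> Uf(B\<^sub>2). h\<^sup>-\<^sup>1[v] \<in> A}\<close> under the Stone dual of \<open>h\<close>.

  For the canonical extension this is a matter of maximality.  If \<open>v\<close> lies in all \<open>\<phi>\<^sub>2(h(a))\<close> for
  \<open>a\<close> in a filter \<open>F\<close>, then \<open>F \<subseteq> h\<^sup>-\<^sup>1[v]\<close>, so the ultrafilter \<open>h\<^sup>-\<^sup>1[v]\<close> belongs to the closed set
  \<open>\<Inter>\<phi>\<^sub>1[F]\<close>.  Conversely the filter \<open>F = h\<^sup>-\<^sup>1[v]\<close> is itself admissible, because the closed set that
  it determines is the single point \<open>h\<^sup>-\<^sup>1[v]\<close> (\<open>canonical_extension_eq_preimage\<close>).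

  For the other map, the Stone-Cech extension of any \<open>f : Y \<rightarrow> X\<close> is the Stone dual of the
  homomorphism \<open>A \<mapsto> f\<^sup>-\<^sup>1[A]\<close> of powerset algebras, that is \<open>\<nabla> \<mapsto> {A. f\<^sup>-\<^sup>1[A] \<in> \<nabla>}\<close>; it is the only
  continuous extension since \<open>Y\<close> is dense in its compactification and Stone spaces are Hausdorff
  (\<open>stone_cech_universal\<close>).  Dualizing back returns the homomorphism \<open>A \<mapsto> f\<^sup>-\<^sup>1[A]\<close>
  (\<open>boolean_dual_stone_cech_extension\<close>), here with \<open>f = h\<^sub>*\<close>.
\<close>

section \<open>Ultrafilters of principal ideals\<close>

text \<open>
  The two carriers that occur are principal ideals \<open>{..t}\<close> of a Boolean algebra: the whole type is
  \<open>{..top}\<close> and \<open>Pow X\<close> is \<open>{..X}\<close>.  Such an ideal is a Boolean algebra with complement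
  \<open>a \<mapsto> t - a\<close>, so one treatment serves both cases.
\<close>

lemma UNIV_eq_atMost_top: "(UNIV :: 'a::order_top set) = {..top}"
  by auto

lemma Pow_eq_atMost: "Pow X = {..X}"
  by auto

lemma inf_relative_complement:
  fixes a t :: "'a::boolean_algebra"
  shows "inf a (t - a) = bot"
  by (simp add: diff_eq inf.left_commute)

lemma Fi_D:
  assumes "F \<in> Fi {..t}"
  shows Fi_le: "a \<in> F \<Longrightarrow> a \<le> t"
    and Fi_inf: "a \<in> F \<Longrightarrow> b \<in> F \<Longrightarrow> inf a b \<in> F"
    and Fi_up: "a \<in> F \<Longrightarrow> a \<le> b \<Longrightarrow> b \<le> t \<Longrightarrow> b \<in> F"
    and Fi_nonempty: "F \<noteq> {}"
  using assms unfolding Fi_def by auto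

lemma Fi_bot_iff:
  fixes t :: "'a::boolean_algebra"
  assumes "F \<in> Fi {..t}"
  shows "bot \<in> F \<longleftrightarrow> F = {..t}"
  using Fi_le[OF assms] Fi_up[OF assms, of bot] by auto

lemma Fi_top:
  assumes "F \<in> Fi {..t}"
  shows "t \<in> F"
  using Fi_nonempty[OF assms] Fi_le[OF assms] Fi_up[OF assms] by blast

text \<open>
  Maximality is prime-ness: if \<open>u\<close> is maximal and omits \<open>a\<close>, then the filter generated by \<open>u\<close> and
  \<open>a\<close> contains \<open>bot\<close>, so some element of \<open>u\<close> lies below \<open>t - a\<close>.
\<close>

lemma Uf_iff:
  fixes t :: "'a::boolean_algebra"
  shows "u \<in> Uf {..t} \<longleftrightarrow> u \<in> Fi {..t} \<and> bot \<notin> u \<and> (\<forall>a\<le>t. a \<in> u \<or> t - a \<in> u)"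
proof (intro iffI conjI allI impI)
  assume u: "u \<in> Uf {..t}"
  then show fi: "u \<in> Fi {..t}" by (simp add: Uf_def)
  show "bot \<notin> u"
    using u Fi_bot_iff[OF fi] by (auto simp: Uf_def)
  fix a assume a: "a \<le> t"
  have "t - a \<in> u" if na: "a \<notin> u"
  proof -
    define F where "F = {x. x \<le> t \<and> (\<exists>b\<in>u. inf b a \<le> x)}"
    have "F \<in> Fi {..t}"
      unfolding Fi_def
    proof (intro CollectI conjI ballI impI)
      show "F \<subseteq> {..t}" by (auto simp: F_def)
      show "F \<noteq> {}"
        using Fi_nonempty[OF fi] a by (auto simp: F_def intro: le_infI2)
    next
      fix x y assume "x \<in> F" "y \<in> F"
      then obtain b c where "x \<le> t" "b \<in> u" "inf b a \<le> x" "c \<in> u" "inf c a \<le> y"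
        by (auto simp: F_def)
      moreover from this have "inf (inf b c) a \<le> inf x y"
        by (meson inf.cobounded1 inf.cobounded2 inf_mono le_infI order_refl order_trans)
      ultimately show "inf x y \<in> F"
        using Fi_inf[OF fi] by (auto simp: F_def intro: le_infI1)
    next
      fix x y assume "x \<in> F" "y \<in> {..t}" "x \<le> y"
      then show "y \<in> F" by (auto simp: F_def intro: order_trans)
    qed
    moreover have "u \<subseteq> F"
      using Fi_le[OF fi] by (auto simp: F_def intro: inf.cobounded1)
    moreover have "a \<in> F"
      using Fi_nonempty[OF fi] a by (auto simp: F_def)
    ultimately have "F = {..t}"
      using u na by (auto simp: Uf_def)
    then have "bot \<in> F" by simp
    then obtain b where b: "b \<in> u" "inf b a = bot"
      by (auto simp: F_def bot_unique)
    then have "b \<le> t - a"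
      using Fi_le[OF fi] by (simp add: diff_eq inf_shunt)
    then show "t - a \<in> u"
      using Fi_up[OF fi b(1)] by (simp add: diff_eq)
  qed
  then show "a \<in> u \<or> t - a \<in> u" by blast
next
  assume u: "u \<in> Fi {..t} \<and> bot \<notin> u \<and> (\<forall>a\<le>t. a \<in> u \<or> t - a \<in> u)"
  have "F = {..t}" if F: "F \<in> Fi {..t}" "u \<subseteq> F" "F \<noteq> u" for F
  proof -
    from F obtain a where a: "a \<in> F" "a \<notin> u" by blast
    then have "t - a \<in> F" using u F Fi_le[OF F(1)] by blast
    then have "bot \<in> F"
      using Fi_inf[OF F(1) a(1)] by (metis inf_relative_complement)
    then show ?thesis using Fi_bot_iff[OF F(1)] by simp
  qed
  then show "u \<in> Uf {..t}" using u by (auto simp: Uf_def)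
qed

lemma Uf_Fi: "u \<in> Uf S \<Longrightarrow> u \<in> Fi S"
  by (simp add: Uf_def)

lemma Uf_complement_iff:
  fixes t :: "'a::boolean_algebra"
  assumes "u \<in> Uf {..t}" "a \<le> t"
  shows "t - a \<in> u \<longleftrightarrow> a \<notin> u"
  using assms Fi_inf[OF Uf_Fi[OF assms(1)], of a "t - a"]
  by (auto simp: Uf_iff inf_relative_complement)

lemma Uf_maximal:
  assumes "u \<in> Uf S" "w \<in> Uf S" "u \<subseteq> w"
  shows "w = u"
  using assms unfolding Uf_def by blast

text \<open>
  Preservation of meets and complements already forces \<open>k bot = bot\<close>, \<open>k s = t\<close> and monotonicity,
  so \<open>k\<close> is a homomorphism of the two ideals and pulls ultrafilters back to ultrafilters.  This is
  applied both to \<open>h\<close> and to the preimage operation between powerset algebras.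
\<close>

lemma Uf_preimage:
  fixes s :: "'a::boolean_algebra" and t :: "'b::boolean_algebra" and k :: "'a \<Rightarrow> 'b"
  assumes le: "\<And>a. a \<le> s \<Longrightarrow> k a \<le> t"
    and inf: "\<And>a b. a \<le> s \<Longrightarrow> b \<le> s \<Longrightarrow> k (inf a b) = inf (k a) (k b)"
    and compl: "\<And>a. a \<le> s \<Longrightarrow> k (s - a) = t - k a"
    and u: "u \<in> Uf {..t}"
  shows "{a. a \<le> s \<and> k a \<in> u} \<in> Uf {..s}"
proof -
  have diff_le: "s - a \<le> s" for a by (simp add: diff_eq)
  have bot: "k bot = bot"
    using inf[of s "s - s"] compl[of s] diff_le[of s]
    by (simp add: inf_relative_complement)
  have top: "k s = t"
    using compl[of bot] bot by (simp add: diff_eq)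
  have mono: "k a \<le> k b" if "a \<le> b" "b \<le> s" for a b
    using inf[of a b] that by (metis inf.absorb_iff1 order_trans)
  note fi = Uf_Fi[OF u]
  define F where "F = {a. a \<le> s \<and> k a \<in> u}"
  have "F \<in> Fi {..s}"
    unfolding Fi_def
  proof (intro CollectI conjI ballI impI)
    show "F \<noteq> {}"
      using Fi_top[OF fi] top by (auto simp: F_def)
  next
    fix a b assume "a \<in> F" "b \<in> {..s}" "a \<le> b"
    then show "b \<in> F"
      using Fi_up[OF fi, of "k a" "k b"] mono le by (auto simp: F_def)
  qed (use Fi_inf[OF fi] inf in \<open>auto simp: F_def intro: le_infI1\<close>)
  then show ?thesis
    using u le compl bot diff_le unfolding Uf_iff F_def by auto
qed

section \<open>The canonical extension as a preimage map\<close>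

lemma stone_dual_Uf:
  assumes "boolean_hom h" "v \<in> Uf UNIV"
  shows "stone_dual h v \<in> Uf UNIV"
proof -
  have "{a. a \<le> top \<and> h a \<in> v} \<in> Uf {..top}"
  proof (rule Uf_preimage)
    show "v \<in> Uf {..top}"
      using assms(2) unfolding UNIV_eq_atMost_top .
  qed (use assms(1) in \<open>auto simp: boolean_hom_def diff_eq\<close>)
  then show ?thesis
    by (simp add: stone_dual_def vimage_def flip: UNIV_eq_atMost_top)
qed

lemma canonical_extension_eq_preimage:
  fixes h :: "'a::boolean_algebra \<Rightarrow> 'b::boolean_algebra"
  assumes h: "boolean_hom h"
  shows "canonical_extension h A = {v \<in> Uf UNIV. stone_dual h v \<in> A}"
proof (intro equalityI subsetI)
  fix v assume "v \<in> canonical_extension h A"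
  then obtain F where F: "F \<in> Fi UNIV" "\<Inter> (phi UNIV ` F) \<subseteq> A"
      and v: "\<And>a. a \<in> F \<Longrightarrow> v \<in> phi UNIV (h a)"
    unfolding canonical_extension_def by blast
  \<comment> \<open>An intersection over the empty family would be everything, so that \<open>v\<close> is an ultrafilter
      at all depends on filters being nonempty.\<close>
  have "v \<in> Uf UNIV"
    using F(1) v by (auto simp: Fi_def phi_def)
  moreover from this have "stone_dual h v \<in> \<Inter> (phi UNIV ` F)"
    using v stone_dual_Uf[OF h] by (auto simp: phi_def stone_dual_def)
  ultimately show "v \<in> {v \<in> Uf UNIV. stone_dual h v \<in> A}"
    using F(2) by auto
next
  fix v assume "v \<in> {v \<in> Uf UNIV. stone_dual h v \<in> A}"
  then have v: "v \<in> Uf UNIV" "stone_dual h v \<in> A" by auto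
  note w = stone_dual_Uf[OF h v(1)]
  have "stone_dual h v \<noteq> {}"
    using w by (auto simp: Uf_def Fi_def)
  then have "\<Inter> (phi UNIV ` stone_dual h v) \<subseteq> {stone_dual h v}"
    using Uf_maximal[OF w] by (auto simp: phi_def)
  moreover have "v \<in> \<Inter> {phi UNIV (h a) | a. a \<in> stone_dual h v}"
    using v by (auto simp: phi_def stone_dual_def)
  ultimately show "v \<in> canonical_extension h A"
    using v(2) Uf_Fi[OF w] unfolding canonical_extension_def by blast
qed

section \<open>Stone spaces\<close>

lemma topspace_stone_space:
  "topspace (stone_space {..t}) = Uf {..t}"
proof -
  have "u \<in> phi {..t} t" if "u \<in> Uf {..t}" for u
    using that Fi_top[OF Uf_Fi] by (simp add: phi_def)
  then show ?thesis
    by (auto simp: stone_space_def topology_generated_by_topspace phi_def)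
qed

lemma openin_phi:
  "a \<in> S \<Longrightarrow> openin (stone_space S) (phi S a)"
  unfolding stone_space_def by (simp add: topology_generated_by_Basis)

lemma Hausdorff_stone_space:
  fixes t :: "'a::boolean_algebra"
  shows "Hausdorff_space (stone_space {..t})"
  unfolding Hausdorff_space_def topspace_stone_space
proof (intro allI impI, elim conjE)
  fix u w assume u: "u \<in> Uf {..t}" and w: "w \<in> Uf {..t}" and "u \<noteq> w"
  then obtain a where a: "a \<in> u" "a \<notin> w"
    using Uf_maximal by blast
  have le: "a \<le> t" using Fi_le[OF Uf_Fi[OF u]] a by blast
  have "w \<in> phi {..t} (t - a)"
    using a w Uf_complement_iff[OF w le] by (simp add: phi_def)
  moreover have "disjnt (phi {..t} a) (phi {..t} (t - a))"
    using Uf_complement_iff[OF _ le] by (auto simp: disjnt_def phi_def)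
  moreover have "openin (stone_space {..t}) (phi {..t} (t - a))"
    by (rule openin_phi) (simp add: diff_eq)
  moreover have "openin (stone_space {..t}) (phi {..t} a)" "u \<in> phi {..t} a"
    using le a u by (simp_all add: openin_phi) (simp add: phi_def)
  ultimately show "\<exists>U V. openin (stone_space {..t}) U \<and> openin (stone_space {..t}) V \<and>
      u \<in> U \<and> w \<in> V \<and> disjnt U V"
    by blast
qed

text \<open>
  The generating sets form a base, not only a subbase, because
  \<open>\<phi>(a) \<inter> \<phi>(b) = \<phi>(a \<sqinter> b)\<close>.
\<close>

lemma stone_space_basic_nbhd:
  assumes "openin (stone_space {..t}) U" "u \<in> U"
  shows "\<exists>a\<in>u. phi {..t} a \<subseteq> U"
proof -
  have "generate_topology_on (phi {..t} ` {..t}) U"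
    using assms(1) by (simp add: stone_space_def openin_topology_generated_by_iff)
  then show ?thesis
    using assms(2)
  proof (induction arbitrary: u)
    case (Int U V)
    then have "U \<inter> V \<subseteq> Uf {..t}"
      using openin_subset[of "stone_space {..t}" U]
      unfolding topspace_stone_space by (auto simp: stone_space_def openin_topology_generated_by_iff)
    then have fi: "u \<in> Fi {..t}" using Int.prems Uf_Fi by blast
    from Int obtain a b where ab: "a \<in> u" "b \<in> u" "phi {..t} a \<subseteq> U" "phi {..t} b \<subseteq> V"
      by (metis IntE)
    have "phi {..t} (inf a b) \<subseteq> phi {..t} a \<inter> phi {..t} b"
      using Fi_up[OF Uf_Fi, of _ t "inf a b"] Fi_le[OF fi] ab by (auto simp: phi_def)
    then show ?case using ab Fi_inf[OF fi] by blast
  next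
    case (UN K)
    then show ?case by (meson UnionE Union_upper order_trans)
  next
    case (Basis s)
    then show ?case by (auto simp: phi_def)
  qed simp
qed

section \<open>The Stone-Cech compactification of a discrete space\<close>

lemma topspace_stone_cech: "topspace (stone_cech X) = Uf (Pow X)"
  by (simp add: stone_cech_def Pow_eq_atMost topspace_stone_space)

lemma stone_cech_embed_Uf:
  assumes "x \<in> X"
  shows "stone_cech_embed X x \<in> Uf (Pow X)"
  unfolding Pow_eq_atMost Uf_iff
  using assms by (auto simp: stone_cech_embed_def Fi_def)

lemma mem_phi_stone_cech_embed_iff:
  assumes "x \<in> X" "A \<subseteq> X"
  shows "stone_cech_embed X x \<in> phi (Pow X) A \<longleftrightarrow> x \<in> A"
  using assms stone_cech_embed_Uf[OF assms(1)] by (auto simp: phi_def stone_cech_embed_def)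

lemma phi_Pow_inj:
  assumes "A \<subseteq> X" "B \<subseteq> X" "phi (Pow X) A = phi (Pow X) B"
  shows "A = B"
proof -
  have "x \<in> A \<longleftrightarrow> x \<in> B" if "x \<in> X" for x
    using mem_phi_stone_cech_embed_iff[OF that assms(1)]
      mem_phi_stone_cech_embed_iff[OF that assms(2)] assms(3) by simp
  then show ?thesis using assms(1,2) by blast
qed

text \<open>
  A basic neighbourhood \<open>\<phi>(C)\<close> of an ultrafilter has \<open>C\<close> nonempty, and the principal
  ultrafilter of any point of \<open>C\<close> lies in it.
\<close>

lemma stone_cech_embed_dense:
  "stone_cech X closure_of (stone_cech_embed X ` X) = topspace (stone_cech X)"
  unfolding dense_intersects_open
proof (intro allI impI)
  fix U assume U: "openin (stone_cech X) U \<and> U \<noteq> {}"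
  then obtain u where u: "u \<in> U" by blast
  then have uf: "u \<in> Uf {..X}"
    using U openin_subset[of "stone_cech X" U] by (auto simp: topspace_stone_cech Pow_eq_atMost)
  from U u obtain C where C: "C \<in> u" "phi {..X} C \<subseteq> U"
    using stone_space_basic_nbhd[of X U u] by (auto simp: stone_cech_def Pow_eq_atMost)
  then have "C \<noteq> {}" "C \<subseteq> X"
    using uf Fi_le[OF Uf_Fi[OF uf]] by (auto simp: Uf_iff)
  then obtain x where "x \<in> C" "x \<in> X" by blast
  then have "stone_cech_embed X x \<in> phi (Pow X) C"
    using \<open>C \<subseteq> X\<close> by (simp add: mem_phi_stone_cech_embed_iff)
  then show "stone_cech_embed X ` X \<inter> U \<noteq> {}"
    using C \<open>x \<in> X\<close> by (auto simp: Pow_eq_atMost)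
qed

text \<open>The Stone dual of the homomorphism \<open>A \<mapsto> f\<^sup>-\<^sup>1[A]\<close> from \<open>Pow X\<close> to \<open>Pow Y\<close>.\<close>

definition stone_cech_extension ::
  "'x set \<Rightarrow> 'y set \<Rightarrow> ('y \<Rightarrow> 'x) \<Rightarrow> 'y set set \<Rightarrow> 'x set set" where
  "stone_cech_extension X Y f =
     restrict (\<lambda>n. {A. A \<subseteq> X \<and> {y \<in> Y. f y \<in> A} \<in> n}) (Uf (Pow Y))"

lemma stone_cech_extension_Uf:
  assumes f: "f \<in> Y \<rightarrow> X" and n: "n \<in> Uf (Pow Y)"
  shows "stone_cech_extension X Y f n \<in> Uf (Pow X)"
proof -
  have "{A. A \<le> X \<and> {y \<in> Y. f y \<in> A} \<in> n} \<in> Uf {..X}"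
    using f n by (intro Uf_preimage[where t = Y]) (auto simp: Pow_eq_atMost)
  then show ?thesis
    using n by (simp add: stone_cech_extension_def Pow_eq_atMost)
qed

lemma vimage_phi_stone_cech_extension:
  assumes "f \<in> Y \<rightarrow> X" "A \<subseteq> X"
  shows "{n \<in> Uf (Pow Y). stone_cech_extension X Y f n \<in> phi (Pow X) A}
           = phi (Pow Y) {y \<in> Y. f y \<in> A}"
  using assms stone_cech_extension_Uf[OF assms(1)]
  by (auto simp: phi_def stone_cech_extension_def)

lemma stone_cech_extension_continuous:
  assumes f: "f \<in> Y \<rightarrow> X"
  shows "continuous_map (stone_cech Y) (stone_cech X) (stone_cech_extension X Y f)"
  unfolding stone_cech_def[of X] stone_space_def
proof (rule continuous_on_generated_topo)
  fix U assume "U \<in> phi (Pow X) ` Pow X"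
  then obtain A where A: "A \<subseteq> X" "U = phi (Pow X) A" by auto
  have "stone_cech_extension X Y f -` U \<inter> topspace (stone_cech Y) = phi (Pow Y) {y \<in> Y. f y \<in> A}"
    using vimage_phi_stone_cech_extension[OF f A(1)] A(2) by (auto simp: topspace_stone_cech)
  then show "openin (stone_cech Y) (stone_cech_extension X Y f -` U \<inter> topspace (stone_cech Y))"
    by (simp add: stone_cech_def openin_phi)
next
  have "\<Union> (phi (Pow X) ` Pow X) = Uf (Pow X)"
    using topspace_stone_cech[of X]
    by (simp add: stone_cech_def stone_space_def topology_generated_by_topspace)
  then show "stone_cech_extension X Y f ` topspace (stone_cech Y) \<subseteq> \<Union> (phi (Pow X) ` Pow X)"
    using stone_cech_extension_Uf[OF f] by (auto simp: topspace_stone_cech)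
qed

lemma stone_cech_extension_embed:
  assumes f: "f \<in> Y \<rightarrow> X" and y: "y \<in> Y"
  shows "stone_cech_extension X Y f (stone_cech_embed Y y) = stone_cech_embed X (f y)"
  using stone_cech_embed_Uf[OF y] y
  by (auto simp: stone_cech_extension_def stone_cech_embed_def)

text \<open>
  An extension is determined by its values on the dense set of principal ultrafilters, because the
  target is Hausdorff.
\<close>

lemma stone_cech_universal:
  assumes f: "f \<in> Y \<rightarrow> X"
  shows "g \<in> extensional (topspace (stone_cech Y)) \<and>
         continuous_map (stone_cech Y) (stone_cech X) g \<and>
         (\<forall>y\<in>Y. g (stone_cech_embed Y y) = stone_cech_embed X (f y))
       \<longleftrightarrow> g = stone_cech_extension X Y f" (is "?ext g \<longleftrightarrow> _")
proof
  assume g: "?ext g"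
  have "Hausdorff_space (stone_cech X)"
    by (simp add: stone_cech_def Pow_eq_atMost Hausdorff_stone_space)
  moreover have "n \<in> stone_cech Y closure_of (stone_cech_embed Y ` Y)" if "n \<in> Uf (Pow Y)" for n
    using that by (simp add: stone_cech_embed_dense topspace_stone_cech)
  moreover have "g z = stone_cech_extension X Y f z" if "z \<in> stone_cech_embed Y ` Y" for z
    using that g stone_cech_extension_embed[OF f] by auto
  ultimately have "g n = stone_cech_extension X Y f n" if "n \<in> Uf (Pow Y)" for n
    using forall_in_closure_of_eq[of n "stone_cech Y" "stone_cech_embed Y ` Y" "stone_cech X" g]
      that g stone_cech_extension_continuous[OF f] by blast
  then show "g = stone_cech_extension X Y f"
    using g by (intro extensionalityI[of _ "Uf (Pow Y)"])
      (auto simp: topspace_stone_cech stone_cech_extension_def)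
next
  have "stone_cech_extension X Y f \<in> extensional (topspace (stone_cech Y))"
    unfolding stone_cech_extension_def topspace_stone_cech by (rule restrict_extensional)
  moreover assume "g = stone_cech_extension X Y f"
  ultimately show "?ext g"
    using stone_cech_extension_continuous[OF f] stone_cech_extension_embed[OF f] by simp
qed

lemma boolean_dual_stone_cech_extension:
  assumes f: "f \<in> Y \<rightarrow> X" and A: "A \<subseteq> X"
  shows "boolean_dual X Y (stone_cech_extension X Y f) A = {y \<in> Y. f y \<in> A}"
  unfolding boolean_dual_def topspace_stone_cech vimage_phi_stone_cech_extension[OF f A]
  by (rule the_equality) (simp, rule phi_Pow_inj[of _ Y], auto)

section \<open>Agreement of the two maps\<close>

lemma stone_cech_dual_eq_extension:
  fixes h :: "'a::boolean_algebra \<Rightarrow> 'b::boolean_algebra"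
  assumes "boolean_hom h"
  shows "stone_cech_dual h = stone_cech_extension (Uf UNIV) (Uf UNIV) (stone_dual h)"
proof -
  have "stone_dual h \<in> Uf UNIV \<rightarrow> Uf UNIV"
    using stone_dual_Uf[OF assms] by blast
  then show ?thesis
    unfolding stone_cech_dual_def by (subst stone_cech_universal) auto
qed

theorem theorem4p2:
  fixes h :: "'a::boolean_algebra \<Rightarrow> 'b::boolean_algebra"
  assumes "boolean_hom h"
  shows "\<forall>A \<in> Pow (Uf (UNIV :: 'a set)).
           canonical_extension h A
             = boolean_dual (Uf (UNIV :: 'a set)) (Uf (UNIV :: 'b set)) (stone_cech_dual h) A"
proof
  fix A assume "A \<in> Pow (Uf (UNIV :: 'a set))"
  moreover have "stone_dual h \<in> Uf UNIV \<rightarrow> Uf UNIV"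
    using stone_dual_Uf[OF assms] by blast
  ultimately show "canonical_extension h A
      = boolean_dual (Uf (UNIV :: 'a set)) (Uf (UNIV :: 'b set)) (stone_cech_dual h) A"
    by (simp add: canonical_extension_eq_preimage[OF assms] stone_cech_dual_eq_extension[OF assms]
        boolean_dual_stone_cech_extension)
qed

end
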